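(* Queue-number, track-number and convex antithickness are (pairwise) tied.
   Context: All graphs are undirected, finite and simple. Tied: a graph parameter is a function assigning a non-negative integer to every graph. A parameter $\beta$ is bounded by a parameter $\gamma$ if there exists a function $g$ such that $\beta(G)\leq g(\gamma(G))$ for every graph $G$. Two parameters are tied if each is bounded by the other. Queue-number: a vertex ordering of $G$ is a total order $<_\pi$ on $V(G)$. For an edge $e$, let $L(e)<_\pi R(e)$ be its end-vertices. Two edges $e,f$ with no common end-vertex nest if $L(e)<_\pi L(f)<_\pi R(f)<_\pi R(e)$ or $L(f)<_\pi L(e)<_\pi R(e)<_\pi R(f)$. A queue is a set of edges no two of which nest. A $k$-queue layout of $G$ consists of a vertex ordering $\pi$ and a partition of $E(G)$ into $k$ queues in $\pi$. The queue-number of $G$ is the minimum $k$ such that $G$ has a $k$-queue layout. Track-number: a $t$-track assignment of $G$ is a partition $V_1,\dots,V_t$ of $V(G)$ such that the end-vertices of every edge are in distinct classes, together with a total order $<_i$ on each $V_i$. An X-crossing consists of two edges $vw$ and $xy$ with $v,x\in V_i$, $w,y\in V_j$, $i\neq j$, $v<_i x$ and $y<_j w$. A $(k,t)$-track layout of $G$ consists of a $t$-track assignment of $G$ and a partition of $E(G)$ into $k$ colour classes with no X-crossing formed by two edges of the same colour. The track-number of $G$ is the minimum $t$ such that $G$ has a $(1,t)$-track layout. Convex antithickness: a geometric drawing of a graph maps vertices to distinct points in the plane and edges to straight line segments between their end-vertices, such that no edge passes through a vertex other than its own end-vertices. It is convex if every vertex is on the convex hull of the set of vertices. A set of edges in a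 drawing is a thrackle if every pair of distinct edges in it intersect exactly once (at a common end-vertex or at a crossing point). The antithickness of a drawing is the minimum $k$ such that its edges can be partitioned into $k$ thrackles. The convex antithickness of $G$ is the minimum $k$ such that $G$ has a convex drawing with antithickness $k$. *)

theory Defs
  imports "HOL-Analysis.Analysis"
begin

(* A graph is a pair of a vertex set and a set of two-element vertex sets. *)

type_synonym 'a graph = "'a set \<times> 'a set set"

abbreviation verts :: "'a graph \<Rightarrow> 'a set" where "verts \<equiv> fst"
abbreviation edges :: "'a graph \<Rightarrow> 'a set set" where "edges \<equiv> snd"

definition simple_graph :: "'a graph \<Rightarrow> bool" where
  "simple_graph G \<longleftrightarrow> finite (verts G) \<and> (\<forall>e\<in>edges G. e \<subseteq> verts G \<and> card e = 2)"

definition bounded_by :: "('a graph \<Rightarrow> nat) \<Rightarrow> ('a graph \<Rightarrow> nat) \<Rightarrow> bool" where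
  "bounded_by \<beta> \<gamma> \<longleftrightarrow> (\<exists>g :: nat \<Rightarrow> nat. \<forall>G. simple_graph G \<longrightarrow> \<beta> G \<le> g (\<gamma> G))"

definition tied :: "('a graph \<Rightarrow> nat) \<Rightarrow> ('a graph \<Rightarrow> nat) \<Rightarrow> bool" where
  "tied \<beta> \<gamma> \<longleftrightarrow> bounded_by \<beta> \<gamma> \<and> bounded_by \<gamma> \<beta>"

(* Classes may be empty, so that an edgeless graph has a (1,t)-track layout.  None of the minima
   over the number of queues, tracks or thrackles below depends on this, since empty classes can
   be dropped. *)

definition indexed_partition :: "'b set \<Rightarrow> nat \<Rightarrow> (nat \<Rightarrow> 'b set) \<Rightarrow> bool" where
  "indexed_partition S k P \<longleftrightarrow> (\<Union>i<k. P i) = S \<and> disjoint_family_on P {..<k}"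

(* Vertex orders are given by strict relations: (u, v) \<in> r means u < v.  Pairs of r that lie
   outside the set being ordered play no role. *)

definition nest :: "('a \<times> 'a) set \<Rightarrow> 'a set \<Rightarrow> 'a set \<Rightarrow> bool" where
  "nest r e f \<longleftrightarrow> e \<inter> f = {} \<and>
    (\<exists>le re lf rf. e = {le, re} \<and> (le, re) \<in> r \<and> f = {lf, rf} \<and> (lf, rf) \<in> r \<and>
      ((le, lf) \<in> r \<and> (lf, rf) \<in> r \<and> (rf, re) \<in> r \<or>
       (lf, le) \<in> r \<and> (le, re) \<in> r \<and> (re, rf) \<in> r))"

definition queue :: "('a \<times> 'a) set \<Rightarrow> 'a set set \<Rightarrow> bool" where
  "queue r Q \<longleftrightarrow> (\<forall>e\<in>Q. \<forall>f\<in>Q. \<not> nest r e f)"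

definition queue_layout ::
    "'a graph \<Rightarrow> nat \<Rightarrow> ('a \<times> 'a) set \<Rightarrow> (nat \<Rightarrow> 'a set set) \<Rightarrow> bool" where
  "queue_layout G k r Q \<longleftrightarrow> strict_linear_order_on (verts G) r \<and>
     indexed_partition (edges G) k Q \<and> (\<forall>i<k. queue r (Q i))"

definition queue_number :: "'a graph \<Rightarrow> nat" where
  "queue_number G = (LEAST k. \<exists>r Q. queue_layout G k r Q)"

definition track_assignment ::
    "'a graph \<Rightarrow> nat \<Rightarrow> (nat \<Rightarrow> 'a set) \<Rightarrow> (nat \<Rightarrow> ('a \<times> 'a) set) \<Rightarrow> bool" where
  "track_assignment G t V r \<longleftrightarrow> indexed_partition (verts G) t V \<and>
     (\<forall>e\<in>edges G. \<forall>v\<in>e. \<forall>w\<in>e. v \<noteq> w \<longrightarrow> \<not> (\<exists>i<t. v \<in> V i \<and> w \<in> V i)) \<and>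
     (\<forall>i<t. strict_linear_order_on (V i) (r i))"

definition X_crossing ::
    "nat \<Rightarrow> (nat \<Rightarrow> 'a set) \<Rightarrow> (nat \<Rightarrow> ('a \<times> 'a) set) \<Rightarrow> 'a set \<Rightarrow> 'a set \<Rightarrow> bool" where
  "X_crossing t V r e f \<longleftrightarrow>
    (\<exists>v w x y i j. e = {v, w} \<and> f = {x, y} \<and> i < t \<and> j < t \<and> i \<noteq> j \<and>
       v \<in> V i \<and> x \<in> V i \<and> w \<in> V j \<and> y \<in> V j \<and> (v, x) \<in> r i \<and> (y, w) \<in> r j)"

definition track_layout ::
    "'a graph \<Rightarrow> nat \<Rightarrow> nat \<Rightarrow> (nat \<Rightarrow> 'a set) \<Rightarrow> (nat \<Rightarrow> ('a \<times> 'a) set) \<Rightarrow>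
     (nat \<Rightarrow> 'a set set) \<Rightarrow> bool" where
  "track_layout G k t V r C \<longleftrightarrow> track_assignment G t V r \<and>
     indexed_partition (edges G) k C \<and>
     (\<forall>c<k. \<forall>e\<in>C c. \<forall>f\<in>C c. \<not> X_crossing t V r e f)"

definition track_number :: "'a graph \<Rightarrow> nat" where
  "track_number G = (LEAST t. \<exists>V r C. track_layout G 1 t V r C)"

(* The plane is the type complex.  For an edge {u, v} this is closed_segment (p u) (p v), by
   segment_convex_hull. *)

definition edge_segment :: "('a \<Rightarrow> complex) \<Rightarrow> 'a set \<Rightarrow> complex set" where
  "edge_segment p e = convex hull (p ` e)"

definition geometric_drawing :: "'a graph \<Rightarrow> ('a \<Rightarrow> complex) \<Rightarrow> bool" where
  "geometric_drawing G p \<longleftrightarrow> inj_on p (verts G) \<and>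
     (\<forall>e\<in>edges G. \<forall>w\<in>verts G - e. p w \<notin> edge_segment p e)"

(* A vertex is "on" the convex hull when it lies on its boundary. *)

definition convex_drawing :: "'a graph \<Rightarrow> ('a \<Rightarrow> complex) \<Rightarrow> bool" where
  "convex_drawing G p \<longleftrightarrow> geometric_drawing G p \<and>
     (\<forall>v\<in>verts G. p v \<in> frontier (convex hull (p ` verts G)))"

(* In a geometric drawing, a point that is the only common point of two distinct edges is either a
   common end-vertex or interior to both edges, i.e. a crossing point. *)

definition thrackle :: "('a \<Rightarrow> complex) \<Rightarrow> 'a set set \<Rightarrow> bool" where
  "thrackle p T \<longleftrightarrow>
     (\<forall>e\<in>T. \<forall>f\<in>T. e \<noteq> f \<longrightarrow> (\<exists>!z. z \<in> edge_segment p e \<and> z \<in> edge_segment p f))"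

definition drawing_antithickness :: "'a graph \<Rightarrow> ('a \<Rightarrow> complex) \<Rightarrow> nat" where
  "drawing_antithickness G p =
     (LEAST k. \<exists>T. indexed_partition (edges G) k T \<and> (\<forall>i<k. thrackle p (T i)))"

definition convex_antithickness :: "'a graph \<Rightarrow> nat" where
  "convex_antithickness G =
     (LEAST k. \<exists>p. convex_drawing G p \<and> drawing_antithickness G p = k)"

end

theory Submission
  imports Defs
begin

text \<open>
  Three inequalities in a cycle suffice: the queue-number is at most the convex antithickness, the
  convex antithickness is at most \<open>t choose 2\<close> for a graph with track-number \<open>t\<close>, and the
  track-number is bounded by a function of the queue-number.

  \<^bold>\<open>Track-number by queue-number.\<close>  Read an edge of a queue as a pair (left end, right end).  As no
  two edges nest, these pairs form a chain in the product order, so each edge leads to the last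
  right neighbour of its left end or to the last left neighbour of its right end
  (\<open>monotone_rel_cover\<close>).  A \<open>k\<close>-queue graph is therefore covered by \<open>2 * k\<close> partial functions
  on the vertices that are monotone for the vertex ordering.  Colour the vertices so that a vertex
  differs in colour from its images and from the images of its images, and so that distinct images
  of one vertex differ.  Boundedly many colours suffice, because monotonicity lets the
  pairs of images under two of the functions be covered by partial functions again
  (\<open>monotone_rel_siblings\<close>), and a graph covered by boundedly many partial functions has bounded
  chromatic number (\<open>colouring_single_valued_relations\<close>).  Take as the track of a vertex its colour
  together with the colours of all its images.  If edges \<open>vw\<close> and \<open>xy\<close> run between the same
  two tracks and \<open>w\<close> is the image of \<open>v\<close> under \<open>F\<close>, then the colouring forces \<open>y\<close> to be the
  image of \<open>x\<close> under the same \<open>F\<close>, and monotonicity excludes an X-crossing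
  (\<open>track_layout_of_monotone_family\<close>).

  \<^bold>\<open>Convex antithickness by track-number.\<close>  Put the vertices on a parabola, track after track and
  each track in its order.  Two edges between the same two tracks that form no X-crossing share an
  end-vertex or cross as chords, so each pair of tracks gives one thrackle
  (\<open>convex_antithickness_le_of_track_layout\<close>).

  \<^bold>\<open>Queue-number by convex antithickness.\<close>  Walk around the convex hull of a convex drawing: forwards
  along the upper boundary, backwards along the lower one.  In this ordering nested edges are drawn
  as disjoint segments (\<open>convex_drawing_order\<close>), so a thrackle is a queue.  Since
  vertices may be collinear and the hull may be degenerate, the argument uses only supporting
  lines at the vertices and the fact that no edge passes through a vertex.
\<close>

section \<open>Finite partitions and orders\<close>

lemma indexed_partition_by_label:
  assumes "finite L" and "l ` S \<subseteq> L"
  obtains P where "indexed_partition S (card L) P"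
    and "\<And>i x. x \<in> P i \<Longrightarrow> x \<in> S"
    and "\<And>i x y. \<lbrakk>x \<in> P i; y \<in> P i\<rbrakk> \<Longrightarrow> l x = l y"
proof -
  obtain b where b: "bij_betw b {..<card L} L"
    using ex_bij_betw_nat_finite[OF assms(1)] by (auto simp: atLeast0LessThan)
  define P where "P i = {x \<in> S. l x = b i}" for i
  have "(\<Union>i<card L. P i) = S"
    using assms(2) b unfolding P_def bij_betw_def by (auto simp: image_iff subset_iff)
  moreover have "disjoint_family_on P {..<card L}"
    using b unfolding P_def bij_betw_def disjoint_family_on_def by (auto dest: inj_onD)
  ultimately have "indexed_partition S (card L) P"
    unfolding indexed_partition_def by blast
  then show ?thesis
    by (rule that) (auto simp: P_def)
qed

lemma indexed_partition_memberD:
  assumes "indexed_partition S k P" and "i < k" and "x \<in> P i"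
  shows "x \<in> S"
  using assms unfolding indexed_partition_def by blast

lemma simple_graph_finite_edges:
  assumes "simple_graph G"
  shows "finite (edges G)"
proof -
  have "edges G \<subseteq> Pow (verts G)" and "finite (verts G)"
    using assms unfolding simple_graph_def by auto
  then show ?thesis
    by (meson finite_Pow_iff finite_subset)
qed

lemma strict_linear_order_rank:
  assumes "finite V" and "strict_linear_order_on V r"
  obtains h :: "'a \<Rightarrow> nat" where "\<And>u v. \<lbrakk>u \<in> V; v \<in> V\<rbrakk> \<Longrightarrow> (u, v) \<in> r \<longleftrightarrow> h u < h v"
    and "inj_on h V"
proof -
  define h where "h v = card {u \<in> V. (u, v) \<in> r}" for v
  have trans: "trans r" and irr: "irrefl r" and tot: "total_on V r"
    using assms(2) unfolding strict_linear_order_on_def by auto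
  have mono: "h u < h v" if "u \<in> V" "v \<in> V" "(u, v) \<in> r" for u v
  proof -
    have "{w \<in> V. (w, u) \<in> r} \<subset> {w \<in> V. (w, v) \<in> r}"
      using that irr transD[OF trans] unfolding irrefl_def by blast
    then show ?thesis
      unfolding h_def by (intro psubset_card_mono) (use assms(1) in auto)
  qed
  have iff: "(u, v) \<in> r \<longleftrightarrow> h u < h v" if "u \<in> V" "v \<in> V" for u v
    using that mono[of u v] mono[of v u] tot unfolding total_on_def by (metis less_asym less_irrefl)
  moreover have "inj_on h V"
    using iff tot unfolding inj_on_def total_on_def by (metis less_irrefl)
  ultimately show ?thesis
    by (rule that)
qed

section \<open>Colouring graphs covered by partial functions\<close>

text \<open>
  Each of the partial functions gives a vertex at most one out-neighbour, so the average
  in-degree is at most the number of functions too, and some vertex has no more in-neighbours than that.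
\<close>

lemma sparse_vertex:
  assumes "finite V" and "V \<noteq> {}" and "finite \<R>" and "\<And>R. R \<in> \<R> \<Longrightarrow> single_valued R"
  obtains v where "v \<in> V"
    and "card {x \<in> V. \<exists>R\<in>\<R>. (v, x) \<in> R \<or> (x, v) \<in> R} \<le> 2 * card \<R>"
proof -
  define E where "E = \<Union>\<R> \<inter> V \<times> V"
  have finE: "finite E"
    using assms(1) unfolding E_def by blast
  have out: "card (E `` {v}) \<le> card \<R>" for v
  proof -
    have one: "card (R `` {v} \<inter> V) \<le> 1" if R: "R \<in> \<R>" for R
    proof -
      have "x = y" if "x \<in> R `` {v} \<inter> V" "y \<in> R `` {v} \<inter> V" for x y
        using that single_valuedD[OF assms(4)[OF R]] by blast
      then show ?thesis
        using assms(1) card_le_Suc0_iff_eq[of "R `` {v} \<inter> V"] by auto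
    qed
    have "card (E `` {v}) \<le> card (\<Union>R\<in>\<R>. R `` {v} \<inter> V)"
      using assms(1,3) by (intro card_mono) (auto simp: E_def)
    also have "\<dots> \<le> (\<Sum>R\<in>\<R>. card (R `` {v} \<inter> V))"
      using assms(3) by (rule card_UN_le)
    also have "\<dots> \<le> (\<Sum>R\<in>\<R>. 1)"
      using one by (intro sum_mono)
    finally show ?thesis
      by simp
  qed
  have count: "card D = (\<Sum>v\<in>V. card (D `` {v}))" if "D \<subseteq> V \<times> V" for D
  proof -
    have "D = Sigma V (\<lambda>v. D `` {v})"
      using that by auto
    moreover have "finite (D `` {v})" for v
      using that assms(1) by (meson finite_Image finite_SigmaI finite_subset)
    ultimately show ?thesis
      using card_SigmaI[OF assms(1), of "\<lambda>v. D `` {v}"] by auto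
  qed
  have "\<exists>v\<in>V. card (E\<inverse> `` {v}) \<le> card \<R>"
  proof (rule ccontr)
    assume "\<not> ?thesis"
    then have "(\<Sum>v\<in>V. card \<R>) < (\<Sum>v\<in>V. card (E\<inverse> `` {v}))"
      using assms(1,2) by (intro sum_strict_mono) auto
    also have "\<dots> = card (E\<inverse>)"
      by (rule count[symmetric]) (auto simp: E_def)
    also have "\<dots> = card E"
      by (rule card_inverse)
    also have "\<dots> = (\<Sum>v\<in>V. card (E `` {v}))"
      by (rule count) (auto simp: E_def)
    also have "\<dots> \<le> (\<Sum>v\<in>V. card \<R>)"
      using out by (intro sum_mono)
    finally show False
      by simp
  qed
  then obtain v where v: "v \<in> V" "card (E\<inverse> `` {v}) \<le> card \<R>"
    by blast
  have "{x \<in> V. \<exists>R\<in>\<R>. (v, x) \<in> R \<or> (x, v) \<in> R} = E `` {v} \<union> E\<inverse> `` {v}"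
    using v(1) unfolding E_def by auto
  also have "card \<dots> \<le> card (E `` {v}) + card (E\<inverse> `` {v})"
    by (rule card_Un_le)
  also have "\<dots> \<le> 2 * card \<R>"
    using v(2) out[of v] by simp
  finally show ?thesis
    using that v(1) by blast
qed

lemma colouring_single_valued_relations:
  assumes "finite V" and "finite \<R>" and "\<And>R. R \<in> \<R> \<Longrightarrow> single_valued R"
  shows "\<exists>c :: 'a \<Rightarrow> nat. (\<forall>v. c v \<le> 2 * card \<R>) \<and>
    (\<forall>R\<in>\<R>. \<forall>x\<in>V. \<forall>y\<in>V. (x, y) \<in> R \<longrightarrow> x \<noteq> y \<longrightarrow> c x \<noteq> c y)"
  using assms(1)
proof (induction rule: finite_psubset_induct)
  case (psubset V)
  show ?case
  proof (cases "V = {}")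
    case True
    then show ?thesis
      by (intro exI[of _ "\<lambda>_. 0"]) auto
  next
    case False
    then obtain v where v: "v \<in> V"
      and deg: "card {x \<in> V. \<exists>R\<in>\<R>. (v, x) \<in> R \<or> (x, v) \<in> R} \<le> 2 * card \<R>"
      using sparse_vertex[OF psubset.hyps _ assms(2,3)] by blast
    define N where "N = {x \<in> V. \<exists>R\<in>\<R>. (v, x) \<in> R \<or> (x, v) \<in> R}"
    have "V - {v} \<subset> V"
      using v by blast
    from psubset.IH[OF this] obtain c :: "'a \<Rightarrow> nat" where le: "\<And>w. c w \<le> 2 * card \<R>"
      and proper: "\<And>R x y. \<lbrakk>R \<in> \<R>; x \<in> V - {v}; y \<in> V - {v}; (x, y) \<in> R; x \<noteq> y\<rbrakk> \<Longrightarrow> c x \<noteq> c y"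
      by blast
    have finN: "finite N"
      using psubset.hyps unfolding N_def by simp
    have "card (c ` N) \<le> 2 * card \<R>"
      using deg card_image_le[OF finN, of c] unfolding N_def by linarith
    then have "card (c ` N) < card {..2 * card \<R>}"
      by simp
    then obtain k where k: "k \<le> 2 * card \<R>" "k \<notin> c ` N"
      using finN by (metis atMost_iff card_mono finite_imageI linorder_not_le subsetI)
    have "(c(v := k)) x \<noteq> (c(v := k)) y" if "R \<in> \<R>" "x \<in> V" "y \<in> V" "(x, y) \<in> R" "x \<noteq> y" for R x y
    proof -
      have "x = v \<Longrightarrow> y \<in> N" "y = v \<Longrightarrow> x \<in> N"
        using that unfolding N_def by auto
      then show ?thesis
        using that k(2) proper[of R x y] by auto
    qed
    then show ?thesis
      using le k(1) by (intro exI[of _ "c(v := k)"]) auto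
  qed
qed

section \<open>From queue layouts to track layouts\<close>

definition monotone_rel :: "('a \<Rightarrow> nat) \<Rightarrow> ('a \<times> 'a) set \<Rightarrow> bool" where
  "monotone_rel h P \<longleftrightarrow> (\<forall>a b a' b'. (a, b) \<in> P \<longrightarrow> (a', b') \<in> P \<longrightarrow> h a < h a' \<longrightarrow> h b \<le> h b')"

definition topmost :: "('a \<Rightarrow> nat) \<Rightarrow> ('a \<times> 'a) set \<Rightarrow> ('a \<times> 'a) set" where
  "topmost h P = {(a, b) \<in> P. \<forall>b'. (a, b') \<in> P \<longrightarrow> h b' \<le> h b}"

lemma monotone_relD:
  "\<lbrakk>monotone_rel h P; (a, b) \<in> P; (a', b') \<in> P; h a < h a'\<rbrakk> \<Longrightarrow> h b \<le> h b'"
  unfolding monotone_rel_def by blast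

lemma topmost_subset: "topmost h P \<subseteq> P"
  unfolding topmost_def by auto

lemma monotone_rel_converse: "monotone_rel h P \<Longrightarrow> monotone_rel h (P\<inverse>)"
  unfolding monotone_rel_def by (metis converseD leD le_less_linear)

lemma monotone_rel_topmost: "monotone_rel h P \<Longrightarrow> monotone_rel h (topmost h P)"
  using topmost_subset unfolding monotone_rel_def by blast

lemma single_valued_topmost:
  assumes "inj_on h V" and "P \<subseteq> V \<times> V"
  shows "single_valued (topmost h P)"
proof (rule single_valuedI)
  fix a b b'
  assume ab: "(a, b) \<in> topmost h P" "(a, b') \<in> topmost h P"
  then have "h b = h b'"
    unfolding topmost_def by (intro antisym) auto
  moreover have "b \<in> V" "b' \<in> V"
    using ab assms(2) unfolding topmost_def by auto
  ultimately show "b = b'"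
    using inj_onD[OF assms(1)] by blast
qed

text \<open>
  If \<open>b\<close> is not the last partner of \<open>a\<close>, and \<open>a\<close> is not the last partner of \<open>b\<close>, then a later
  partner of \<open>a\<close> and a later partner of \<open>b\<close> violate monotonicity.  So a monotone relation,
  regardless of how many partners an element has, is covered by two partial functions: this replaces
  a bound on the density of the graph.
\<close>

lemma monotone_rel_cover:
  assumes "monotone_rel h P" and "(a, b) \<in> P"
  shows "(a, b) \<in> topmost h P \<or> (b, a) \<in> topmost h (P\<inverse>)"
proof (rule ccontr)
  assume "\<not> ?thesis"
  then obtain b' a' where "(a, b') \<in> P" "h b < h b'" "(a', b) \<in> P" "h a < h a'"
    using assms(2) unfolding topmost_def by (auto simp: not_le)
  then show False
    using monotone_relD[OF assms(1), of a b' a' b] by simp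
qed

text \<open>
  The pairs of images of a common argument move upwards with that argument.  Together with
  \<open>monotone_rel_cover\<close> this bounds the chromatic number of the graph of siblings, although one vertex
  may have arbitrarily many siblings.
\<close>

lemma monotone_rel_siblings:
  assumes "single_valued F" and "monotone_rel h F" and "monotone_rel h G"
    and "inj_on h V" and "F \<subseteq> V \<times> V" and "G \<subseteq> V \<times> V"
  shows "monotone_rel h (F\<inverse> O G)"
  unfolding monotone_rel_def
proof (intro allI impI)
  fix a b a' b'
  assume "(a, b) \<in> F\<inverse> O G" "(a', b') \<in> F\<inverse> O G" and less: "h a < h a'"
  then obtain v v' where v: "(v, a) \<in> F" "(v, b) \<in> G" and v': "(v', a') \<in> F" "(v', b') \<in> G"
    by blast
  have "v \<noteq> v'"
    using less v v' single_valuedD[OF assms(1)] by blast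
  moreover have "v \<in> V" "v' \<in> V"
    using v v' assms(5) by auto
  ultimately have "h v \<noteq> h v'"
    using assms(4) by (auto dest: inj_onD)
  moreover have "\<not> h v' < h v"
    using monotone_relD[OF assms(2) v'(1) v(1)] less by auto
  ultimately show "h b \<le> h b'"
    using monotone_relD[OF assms(3) v(2) v'(2)] by simp
qed

text \<open>
  With \<open>m\<close> functions, the colouring has to respect the \<open>m\<close> functions, their \<open>m\<^sup>2\<close> composites and
  \<open>m\<^sup>2\<close> functions for siblings, hence \<open>n\<close> colours.  A track is a colour and a set of pairs
  (function, colour).
\<close>

definition track_bound :: "nat \<Rightarrow> nat" where
  "track_bound m = (let n = 2 * (m + 2 * m\<^sup>2) + 1 in n * 2 ^ (m * n))"

text \<open>
  The track of a vertex records its colour and, for each function, the colour of its image.  Vertices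
  \<open>v\<close> and \<open>x\<close> on one track whose neighbours \<open>w\<close> and \<open>y\<close> also lie on one track have
  \<open>F v\<close> and \<open>F x\<close> equally coloured.  If \<open>w = F v\<close>, then \<open>F x\<close> has the colour of \<open>y\<close>,
  and \<open>y\<close> is an image of \<open>x\<close> (so a sibling of \<open>F x\<close>) or \<open>x\<close> is an image of \<open>y\<close> (so \<open>F x\<close> is
  an image of an image of \<open>y\<close>).  In both cases the colouring leaves only \<open>y = F x\<close>.
\<close>

lemma track_layout_of_monotone_family:
  assumes G: "simple_graph G" and inj: "inj_on h (verts G)"
    and fin: "finite \<F>" and card: "card \<F> \<le> m"
    and sv: "\<And>F. F \<in> \<F> \<Longrightarrow> single_valued F"
    and mono: "\<And>F. F \<in> \<F> \<Longrightarrow> monotone_rel h F"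
    and sub: "\<And>F. F \<in> \<F> \<Longrightarrow> F \<subseteq> verts G \<times> verts G"
    and cover: "\<And>e. e \<in> edges G \<Longrightarrow> \<exists>F\<in>\<F>. \<exists>v w. (v, w) \<in> F \<and> e = {v, w}"
  shows "\<exists>t\<le>track_bound m. \<exists>V r C. track_layout G 1 t V r C"
proof -
  \<comment> \<open>Functions, composites and siblings: the constraints on the colouring.\<close>
  define \<R> where "\<R> = \<F> \<union> (\<lambda>(F, F'). F O F') ` (\<F> \<times> \<F>) \<union>
    (\<lambda>(F, F'). topmost h (F\<inverse> O F')) ` (\<F> \<times> \<F>)"
  define n where "n = 2 * (m + 2 * m\<^sup>2) + 1"
  have finR: "finite \<R>"
    using fin unfolding \<R>_def by simp
  have "card \<R> \<le> card \<F> + card (\<F> \<times> \<F>) + card (\<F> \<times> \<F>)"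
    unfolding \<R>_def using fin
    by (intro order_trans[OF card_Un_le] add_mono card_image_le finite_cartesian_product order_refl)
  also have "\<dots> \<le> m + m * m + m * m"
    unfolding card_cartesian_product using card by (intro add_mono mult_mono) auto
  finally have cardR: "2 * card \<R> < n"
    unfolding n_def by (simp add: power2_eq_square)
  have sib_sub: "F\<inverse> O F' \<subseteq> verts G \<times> verts G" if "F \<in> \<F>" "F' \<in> \<F>" for F F'
    using sub[OF that(1)] sub[OF that(2)] by blast
  have R_sv: "single_valued R" if "R \<in> \<R>" for R
  proof -
    have "R \<in> \<F> \<or> (\<exists>F\<in>\<F>. \<exists>F'\<in>\<F>. R = F O F' \<or> R = topmost h (F\<inverse> O F'))"
      using that unfolding \<R>_def by auto
    then show ?thesis
      by (auto intro: sv single_valued_relcomp single_valued_topmost[OF inj sib_sub])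
  qed
  have "finite (verts G)"
    using G unfolding simple_graph_def by simp
  from colouring_single_valued_relations[OF this finR R_sv]
  obtain c :: "'a \<Rightarrow> nat" where c_le: "\<And>v. c v \<le> 2 * card \<R>"
    and proper: "\<And>R x y. \<lbrakk>R \<in> \<R>; x \<in> verts G; y \<in> verts G; (x, y) \<in> R; x \<noteq> y\<rbrakk> \<Longrightarrow> c x \<noteq> c y"
    by blast
  have c_less: "c v < n" for v
    using c_le[of v] cardR by simp
  have c_child: "c v \<noteq> c w" if "F \<in> \<F>" "(v, w) \<in> F" "v \<noteq> w" for F v w
    using that sub[OF that(1)] by (intro proper[of F]) (auto simp: \<R>_def)
  have c_grandchild: "w = u" if "F \<in> \<F>" "F' \<in> \<F>" "(u, v) \<in> F" "(v, w) \<in> F'" "c w = c u" for F F' u v w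
  proof (rule ccontr)
    assume "w \<noteq> u"
    moreover have "F O F' \<in> \<R>"
      using that unfolding \<R>_def by auto
    ultimately show False
      using proper[of "F O F'" u w] that sub[OF that(1)] sub[OF that(2)] by auto
  qed
  have c_siblings: "w = w'" if F: "F \<in> \<F>" "F' \<in> \<F>" and w: "(v, w) \<in> F" "(v, w') \<in> F'" "c w = c w'" for F F' v w w'
  proof (rule ccontr)
    assume ne: "w \<noteq> w'"
    have "monotone_rel h (F\<inverse> O F')"
      using F by (intro monotone_rel_siblings[OF _ _ _ inj] sv mono sub)
    then have "(w, w') \<in> topmost h (F\<inverse> O F') \<or> (w', w) \<in> topmost h (F'\<inverse> O F)"
      using monotone_rel_cover[of h "F\<inverse> O F'" w w'] w by (auto simp: converse_relcomp)
    moreover have "topmost h (F\<inverse> O F') \<in> \<R>" "topmost h (F'\<inverse> O F) \<in> \<R>"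
      using F unfolding \<R>_def by force+
    moreover have "w \<in> verts G" "w' \<in> verts G"
      using sub[OF F(1)] sub[OF F(2)] w by auto
    ultimately show False
      using proper ne w(3) by metis
  qed
  define l where "l v = (c v, {(F, c w) | F w. F \<in> \<F> \<and> (v, w) \<in> F})" for v
  define L where "L = {..<n} \<times> Pow (\<F> \<times> {..<n})"
  have finL: "finite L"
    using fin unfolding L_def by simp
  have "l ` verts G \<subseteq> L"
    using c_less unfolding l_def L_def by auto
  with finL obtain V where part: "indexed_partition (verts G) (card L) V"
    and V_sub: "\<And>i x. x \<in> V i \<Longrightarrow> x \<in> verts G"
    and V_eq: "\<And>i x y. \<lbrakk>x \<in> V i; y \<in> V i\<rbrakk> \<Longrightarrow> l x = l y"
    using indexed_partition_by_label by metis
  have c_eq: "c x = c y" if "l x = l y" for x y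
    using that unfolding l_def by simp
  have child_eq: "\<exists>w'. (y, w') \<in> F \<and> c w' = c w" if "l x = l y" "F \<in> \<F>" "(x, w) \<in> F" for x y F w
  proof -
    have "(F, c w) \<in> snd (l x)"
      using that(2,3) unfolding l_def by auto
    then show ?thesis
      unfolding that(1) unfolding l_def by auto
  qed
  define r where "r = {(u, v). h u < h v}"
  have no_cross: False
    if ends: "{v, w} \<in> edges G" "{x, y} \<in> edges G" "l v = l x" "l w = l y" "h v < h x" "h y < h w"
      and F: "F \<in> \<F>" "(v, w) \<in> F" for v w x y F
  proof -
    obtain z where z: "(x, z) \<in> F" "c z = c y"
      using child_eq[OF ends(3) F] c_eq[OF ends(4)] by auto
    obtain F' v' w' where F': "F' \<in> \<F>" "(v', w') \<in> F'" "{x, y} = {v', w'}"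
      using cover[OF ends(2)] by blast
    then consider "(x, y) \<in> F'" | "(y, x) \<in> F'"
      by (auto simp: doubleton_eq_iff)
    then have "z = y"
    proof cases
      case 1
      then show ?thesis
        using c_siblings[OF F(1) F'(1) z(1) 1 z(2)] by simp
    next
      case 2
      then show ?thesis
        using c_grandchild[OF F'(1) F(1) 2 z(1) z(2)] by simp
    qed
    then show False
      using monotone_relD[OF mono[OF F(1)] F(2) z(1)] ends(5,6) by simp
  qed
  have "track_layout G 1 (card L) V (\<lambda>_. r) (\<lambda>_. edges G)"
    unfolding track_layout_def
  proof (intro conjI allI ballI impI)
    show "indexed_partition (edges G) 1 (\<lambda>_. edges G)"
      unfolding indexed_partition_def disjoint_family_on_def by auto
    show "track_assignment G (card L) V (\<lambda>_. r)"
      unfolding track_assignment_def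
    proof (intro conjI allI ballI impI notI part)
      fix e v w
      assume e: "e \<in> edges G" "v \<in> e" "w \<in> e" "v \<noteq> w" and "\<exists>i<card L. v \<in> V i \<and> w \<in> V i"
      then have "c v = c w"
        using V_eq c_eq by blast
      moreover obtain F a b where F: "F \<in> \<F>" "(a, b) \<in> F" "e = {a, b}"
        using cover[OF e(1)] by blast
      ultimately show False
        using e(2-4) c_child[OF F(1,2)] by auto
    next
      fix i
      have "total_on (V i) r"
        using inj V_sub unfolding total_on_def r_def inj_on_def by (metis (mono_tags) case_prodI linorder_neqE_nat mem_Collect_eq)
      then show "strict_linear_order_on (V i) r"
        unfolding strict_linear_order_on_def r_def trans_def irrefl_def by auto
    qed
  next
    fix i e f
    assume e: "e \<in> edges G" and f: "f \<in> edges G"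
    show "\<not> X_crossing (card L) V (\<lambda>_. r) e f"
    proof
      assume "X_crossing (card L) V (\<lambda>_. r) e f"
      then obtain v w x y where ef: "e = {v, w}" "f = {x, y}"
        and l: "l v = l x" "l w = l y" and less: "h v < h x" "h y < h w"
        using V_eq unfolding X_crossing_def r_def by blast
      obtain F a b where F: "F \<in> \<F>" "(a, b) \<in> F" "{v, w} = {a, b}"
        using cover[OF e] ef(1) by blast
      then consider "(v, w) \<in> F" | "(w, v) \<in> F"
        by (auto simp: doubleton_eq_iff)
      then show False
      proof cases
        case 1
        then show ?thesis
          using no_cross[of v w x y F] e f ef l less F by auto
      next
        case 2
        obtain z where "(y, z) \<in> F" "c z = c x"
          using child_eq[OF l(2) F(1) 2] c_eq[OF l(1)] by auto
        moreover obtain F' v' w' where F': "F' \<in> \<F>" "(v', w') \<in> F'" "{x, y} = {v', w'}"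
          using cover[OF f] ef(2) by blast
        ultimately have "(y, x) \<in> F"
          using c_siblings[OF F(1) F'(1), of y z x] c_grandchild[OF F'(1) F(1), of x y z]
          by (auto simp: doubleton_eq_iff)
        then show ?thesis
          using monotone_relD[OF mono[OF F(1)], of y x w v] 2 less by simp
      qed
    qed
  qed
  moreover have "card L \<le> track_bound m"
  proof -
    have "card L = n * 2 ^ (card \<F> * n)"
      unfolding L_def using fin by (simp add: card_cartesian_product card_Pow)
    also have "\<dots> \<le> n * 2 ^ (m * n)"
      using card by (intro mult_left_mono power_increasing mult_right_mono) auto
    finally show ?thesis
      unfolding track_bound_def n_def Let_def .
  qed
  ultimately show ?thesis
    by blast
qed

text \<open>
  A queue, read as the relation from left ends to right ends, is monotone: a violation would be a
  nesting pair.
\<close>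

lemma track_layout_of_queue_layout:
  assumes G: "simple_graph G" and layout: "queue_layout G k r Q"
  shows "\<exists>t\<le>track_bound (2 * k). \<exists>V r C. track_layout G 1 t V r C"
proof -
  have fin: "finite (verts G)"
    using G unfolding simple_graph_def by simp
  have lin: "strict_linear_order_on (verts G) r" and part: "indexed_partition (edges G) k Q"
    and queue: "\<And>i. i < k \<Longrightarrow> queue r (Q i)"
    using layout unfolding queue_layout_def by auto
  obtain h :: "'a \<Rightarrow> nat" where h: "\<And>u v. \<lbrakk>u \<in> verts G; v \<in> verts G\<rbrakk> \<Longrightarrow> (u, v) \<in> r \<longleftrightarrow> h u < h v"
    and inj: "inj_on h (verts G)"
    using strict_linear_order_rank[OF fin lin] by metis
  define P where "P i = {(a, b). {a, b} \<in> Q i \<and> h a < h b}" for i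
  have P_sub: "P i \<subseteq> verts G \<times> verts G" if "i < k" for i
    using indexed_partition_memberD[OF part that] G unfolding P_def simple_graph_def by blast
  have P_mono: "monotone_rel h (P i)" if i: "i < k" for i
    unfolding monotone_rel_def
  proof (intro allI impI, rule ccontr)
    fix a b a' b'
    assume P: "(a, b) \<in> P i" "(a', b') \<in> P i" and less: "h a < h a'" and "\<not> h b \<le> h b'"
    then have h_less: "h a' < h b'" "h b' < h b" "h a < h b"
      unfolding P_def by auto
    have V: "a \<in> verts G" "b \<in> verts G" "a' \<in> verts G" "b' \<in> verts G"
      using P P_sub[OF i] by auto
    then have "nest r {a, b} {a', b'}"
      unfolding nest_def using h h_less less by (intro conjI exI[of _ a] exI[of _ b] exI[of _ a'] exI[of _ b']) auto
    then show False
      using queue[OF i] P unfolding queue_def P_def by auto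
  qed
  define \<F> where "\<F> = (\<lambda>i. topmost h (P i)) ` {..<k} \<union> (\<lambda>i. topmost h ((P i)\<inverse>)) ` {..<k}"
  show ?thesis
  proof (rule track_layout_of_monotone_family[OF G inj, of \<F>])
    show "finite \<F>"
      unfolding \<F>_def by simp
    have "card \<F> \<le> card {..<k} + card {..<k}"
      unfolding \<F>_def by (intro order_trans[OF card_Un_le] add_mono card_image_le) auto
    then show "card \<F> \<le> 2 * k"
      by simp
  next
    fix F
    assume "F \<in> \<F>"
    then obtain i where i: "i < k" and F: "F = topmost h (P i) \<or> F = topmost h ((P i)\<inverse>)"
      unfolding \<F>_def by auto
    have sub: "P i \<subseteq> verts G \<times> verts G" "(P i)\<inverse> \<subseteq> verts G \<times> verts G"
      using P_sub[OF i] by auto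
    show "single_valued F"
      using F single_valued_topmost[OF inj] sub by auto
    show "monotone_rel h F"
      using F monotone_rel_topmost P_mono[OF i] monotone_rel_converse by blast
    show "F \<subseteq> verts G \<times> verts G"
      using F sub topmost_subset by blast
  next
    fix e
    assume e: "e \<in> edges G"
    then obtain i where i: "i < k" "e \<in> Q i"
      using part unfolding indexed_partition_def by blast
    obtain a b where ab: "e = {a, b}" "a \<noteq> b"
      using G e unfolding simple_graph_def by (meson card_2_iff)
    moreover have "a \<in> verts G" "b \<in> verts G"
      using G e ab(1) unfolding simple_graph_def by auto
    ultimately have "h a \<noteq> h b"
      using inj by (auto dest: inj_onD)
    then have "(a, b) \<in> P i \<or> (b, a) \<in> P i"
      using ab(1) i(2) unfolding P_def by (auto simp: insert_commute)
    then have "\<exists>x y. e = {x, y} \<and> (x, y) \<in> P i"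
      using ab(1) by (auto simp: insert_commute)
    then obtain x y where xy: "e = {x, y}" "(x, y) \<in> P i"
      by blast
    moreover have "topmost h (P i) \<in> \<F>" "topmost h ((P i)\<inverse>) \<in> \<F>"
      using i(1) unfolding \<F>_def by auto
    moreover have "e = {y, x}"
      using xy(1) by auto
    ultimately show "\<exists>F\<in>\<F>. \<exists>v w. (v, w) \<in> F \<and> e = {v, w}"
      using monotone_rel_cover[OF P_mono[OF i(1)]] by blast
  qed
qed

section \<open>From track layouts to convex thrackles\<close>

definition parabola :: "real \<Rightarrow> complex" where
  "parabola x = Complex x (x\<^sup>2)"

lemma parabola_sel [simp]: "Re (parabola x) = x" "Im (parabola x) = x\<^sup>2"
  unfolding parabola_def by simp_all

lemma parabola_eq_iff [simp]: "parabola x = parabola y \<longleftrightarrow> x = y"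
  unfolding parabola_def by auto

lemma edge_segment_insert: "edge_segment p {u, v} = closed_segment (p u) (p v)"
  unfolding edge_segment_def by (simp add: segment_convex_hull)

lemma parabola_chord_line:
  assumes "z \<in> closed_segment (parabola a) (parabola b)"
  shows "Im z = (a + b) * Re z - a * b"
proof -
  obtain t where z: "z = (1 - t) *\<^sub>R parabola a + t *\<^sub>R parabola b"
    using assms unfolding in_segment by blast
  show ?thesis
    unfolding z by (simp add: power2_eq_square algebra_simps)
qed

text \<open>
  The chord over \<open>{a..b}\<close> lies on the line of slope \<open>a + b\<close> and intercept \<open>- a * b\<close>, which turns all
  questions about chords into algebra.
\<close>

lemma parabola_chord_iff:
  assumes "a < b"
  shows "z \<in> closed_segment (parabola a) (parabola b) \<longleftrightarrow>
    a \<le> Re z \<and> Re z \<le> b \<and> Im z = (a + b) * Re z - a * b"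
proof
  assume z: "z \<in> closed_segment (parabola a) (parabola b)"
  then obtain t where t: "0 \<le> t" "t \<le> 1" "z = (1 - t) *\<^sub>R parabola a + t *\<^sub>R parabola b"
    unfolding in_segment by blast
  have "Re z = a + t * (b - a)"
    unfolding t(3) by (simp add: algebra_simps)
  moreover have "0 \<le> t * (b - a)" "t * (b - a) \<le> 1 * (b - a)"
    using t(1,2) assms by (auto intro: mult_right_mono)
  ultimately show "a \<le> Re z \<and> Re z \<le> b \<and> Im z = (a + b) * Re z - a * b"
    using parabola_chord_line[OF z] by simp
next
  assume z: "a \<le> Re z \<and> Re z \<le> b \<and> Im z = (a + b) * Re z - a * b"
  define t where "t = (Re z - a) / (b - a)"
  have t: "t * (b - a) = Re z - a"
    unfolding t_def using assms by simp
  have "0 \<le> t" "t \<le> 1"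
    using z assms unfolding t_def by (auto simp: field_simps)
  moreover have Re: "Re z = (1 - t) * a + t * b"
    using t by (simp add: algebra_simps)
  moreover have "Im z = (1 - t) * a\<^sup>2 + t * b\<^sup>2"
    using z unfolding Re by (simp add: power2_eq_square algebra_simps)
  ultimately show "z \<in> closed_segment (parabola a) (parabola b)"
    unfolding in_segment by (intro exI[of _ t]) (simp add: complex_eq_iff)
qed

lemma parabola_chord_vertex:
  assumes "parabola c \<in> closed_segment (parabola a) (parabola b)"
  shows "c = a \<or> c = b"
proof -
  have "c\<^sup>2 = (a + b) * c - a * b"
    using parabola_chord_line[OF assms] by simp
  then have "(c - a) * (c - b) = 0"
    by (simp add: power2_eq_square algebra_simps)
  then show ?thesis
    by simp
qed

lemma parabola_chords_share:
  assumes "b \<noteq> c"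
  shows "\<exists>!z. z \<in> closed_segment (parabola a) (parabola b) \<and> z \<in> closed_segment (parabola a) (parabola c)"
proof (rule ex1I[of _ "parabola a"])
  fix z
  assume z: "z \<in> closed_segment (parabola a) (parabola b) \<and> z \<in> closed_segment (parabola a) (parabola c)"
  then have eqs: "Im z = (a + b) * Re z - a * b" "Im z = (a + c) * Re z - a * c"
    using parabola_chord_line by blast+
  then have "(b - c) * (Re z - a) = 0"
    by (simp add: algebra_simps)
  then have "Re z = a"
    using assms by simp
  then show "z = parabola a"
    using eqs by (simp add: complex_eq_iff power2_eq_square algebra_simps)
qed simp

lemma parabola_chords_cross:
  assumes "a < c" and "c < b" and "b < d"
  shows "\<exists>!z. z \<in> closed_segment (parabola a) (parabola b) \<and> z \<in> closed_segment (parabola c) (parabola d)"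
proof -
  \<comment> \<open>The first coordinate at which the two chord lines meet.\<close>
  define x where "x = (c * d - a * b) / (c + d - a - b)"
  have pos: "0 < c + d - a - b"
    using assms by simp
  then have x: "x * (c + d - a - b) = c * d - a * b"
    unfolding x_def by simp
  have "(x - c) * (c + d - a - b) = (c - a) * (b - c)"
    unfolding left_diff_distrib x by (simp add: algebra_simps)
  also have "\<dots> \<ge> 0"
    using assms by simp
  finally have "c \<le> x"
    using pos by (simp add: zero_le_mult_iff)
  have "(b - x) * (c + d - a - b) = (b - c) * (d - b)"
    unfolding left_diff_distrib x by (simp add: algebra_simps)
  also have "\<dots> \<ge> 0"
    using assms by simp
  finally have "x \<le> b"
    using pos by (simp add: zero_le_mult_iff)
  have chords: "a < b" "c < d"
    using assms by auto
  show ?thesis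
    unfolding parabola_chord_iff[OF chords(1)] parabola_chord_iff[OF chords(2)]
  proof (rule ex1I[of _ "Complex x ((a + b) * x - a * b)"])
    show "(a \<le> Re (Complex x ((a + b) * x - a * b)) \<and> Re (Complex x ((a + b) * x - a * b)) \<le> b \<and>
        Im (Complex x ((a + b) * x - a * b)) = (a + b) * Re (Complex x ((a + b) * x - a * b)) - a * b) \<and>
      c \<le> Re (Complex x ((a + b) * x - a * b)) \<and> Re (Complex x ((a + b) * x - a * b)) \<le> d \<and>
        Im (Complex x ((a + b) * x - a * b)) = (c + d) * Re (Complex x ((a + b) * x - a * b)) - c * d"
      using \<open>c \<le> x\<close> \<open>x \<le> b\<close> assms x by (simp add: algebra_simps)
  next
    fix z
    assume z: "(a \<le> Re z \<and> Re z \<le> b \<and> Im z = (a + b) * Re z - a * b) \<and>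
      c \<le> Re z \<and> Re z \<le> d \<and> Im z = (c + d) * Re z - c * d"
    then have "(Re z - x) * (c + d - a - b) = 0"
      unfolding left_diff_distrib x by (simp add: algebra_simps)
    then have "Re z = x"
      using pos by simp
    then show "z = Complex x ((a + b) * x - a * b)"
      using z by (simp add: complex_eq_iff)
  qed
qed

text \<open>
  The tangent at a point of the parabola supports the whole parabola.
\<close>

lemma parabola_frontier:
  assumes "a \<in> A"
  shows "parabola a \<in> frontier (convex hull (parabola ` A))"
proof -
  \<comment> \<open>A normal vector of the tangent at \<open>parabola a\<close>.\<close>
  define n where "n = Complex (- 2 * a) 1"
  have inner: "n \<bullet> z = Im z - 2 * a * Re z" for z
    unfolding n_def by (simp add: inner_complex_def)
  have "n \<bullet> parabola x = (x - a)\<^sup>2 - a\<^sup>2" for x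
    unfolding inner by (simp add: power2_eq_square algebra_simps)
  then have "parabola ` A \<subseteq> {z. - a\<^sup>2 \<le> n \<bullet> z}"
    by auto
  then have "convex hull (parabola ` A) \<subseteq> {z. - a\<^sup>2 \<le> n \<bullet> z}"
    by (intro hull_minimal convex_halfspace_ge)
  then have "interior (convex hull (parabola ` A)) \<subseteq> interior {z. n \<bullet> z \<ge> - a\<^sup>2}"
    by (intro interior_mono)
  also have "\<dots> = {z. n \<bullet> z > - a\<^sup>2}"
    by (intro interior_halfspace_ge) (simp add: n_def complex_eq_iff)
  finally have "parabola a \<notin> interior (convex hull (parabola ` A))"
    using inner[of "parabola a"] by (auto simp: power2_eq_square)
  moreover have "parabola a \<in> closure (convex hull (parabola ` A))"
    by (intro subsetD[OF closure_subset] hull_inc imageI assms)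
  ultimately show ?thesis
    unfolding frontier_def by blast
qed

lemma convex_drawing_parabola:
  assumes "simple_graph G" and "inj_on h (verts G)"
  shows "convex_drawing G (\<lambda>v. parabola (h v))"
  unfolding convex_drawing_def geometric_drawing_def
proof (intro conjI ballI)
  show "inj_on (\<lambda>v. parabola (h v)) (verts G)"
    using assms(2) unfolding inj_on_def by simp
next
  fix v
  assume "v \<in> verts G"
  then show "parabola (h v) \<in> frontier (convex hull ((\<lambda>v. parabola (h v)) ` verts G))"
    using parabola_frontier[of "h v" "h ` verts G"] by (simp add: image_image)
next
  fix e w
  assume e: "e \<in> edges G" and w: "w \<in> verts G - e"
  obtain u v where uv: "e = {u, v}"
    using assms(1) e unfolding simple_graph_def by (meson card_2_iff)
  moreover have "u \<in> verts G" "v \<in> verts G"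
    using assms(1) e uv unfolding simple_graph_def by auto
  ultimately have "h w \<noteq> h u" "h w \<noteq> h v"
    using w assms(2) by (auto dest: inj_onD)
  then show "parabola (h w) \<notin> edge_segment (\<lambda>v. parabola (h v)) e"
    using parabola_chord_vertex unfolding uv edge_segment_insert by blast
qed

lemma convex_drawing_exists:
  assumes "simple_graph G"
  shows "\<exists>p. convex_drawing G p"
proof -
  have "finite (verts G)"
    using assms unfolding simple_graph_def by simp
  then obtain h :: "'a \<Rightarrow> nat" where "inj_on h (verts G)"
    using finite_imp_inj_to_nat_seg by blast
  then have "inj_on (\<lambda>v. real (h v)) (verts G)"
    unfolding inj_on_def by simp
  then show ?thesis
    using convex_drawing_parabola[OF assms] by blast
qed

text \<open>
  Along the parabola, two disjoint edges with ends on the same two tracks appear as \<open>a, c, b, d\<close> or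
  as \<open>a, c, d, b\<close>, where the first two points lie on the earlier track.  The second pattern is an
  X-crossing, and in the first one the chords cross.
\<close>

lemma convex_antithickness_le_of_track_layout:
  assumes G: "simple_graph G" and layout: "track_layout G 1 t V r C"
  shows "convex_antithickness G \<le> t choose 2"
proof -
  have fin: "finite (verts G)"
    using G unfolding simple_graph_def by simp
  have assignment: "track_assignment G t V r" and C: "indexed_partition (edges G) 1 C"
    and "\<forall>c<1. \<forall>e\<in>C c. \<forall>f\<in>C c. \<not> X_crossing t V r e f"
    using layout unfolding track_layout_def by auto
  moreover have "C 0 = edges G"
    using C unfolding indexed_partition_def by (simp add: lessThan_Suc)
  ultimately have no_cross: "\<not> X_crossing t V r e f" if "e \<in> edges G" "f \<in> edges G" for e f
    using that by simp
  have part: "indexed_partition (verts G) t V"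
    and lin: "\<And>i. i < t \<Longrightarrow> strict_linear_order_on (V i) (r i)"
    using assignment unfolding track_assignment_def by auto
  have proper: "w \<notin> V i" if "e \<in> edges G" "v \<in> e" "w \<in> e" "v \<noteq> w" "i < t" "v \<in> V i" for e v w i
    using assignment that unfolding track_assignment_def by blast
  have "\<forall>v\<in>verts G. \<exists>i<t. v \<in> V i"
    using part unfolding indexed_partition_def by blast
  then obtain tr where tr: "\<And>v. v \<in> verts G \<Longrightarrow> tr v < t \<and> v \<in> V (tr v)"
    by metis
  \<comment> \<open>The order along the parabola: track by track.\<close>
  define S where "S = {(u, v). u \<in> verts G \<and> v \<in> verts G \<and> (tr u < tr v \<or> tr u = tr v \<and> (u, v) \<in> r (tr u))}"
  have "strict_linear_order_on (verts G) S"
    unfolding strict_linear_order_on_def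
  proof (intro conjI)
    show "trans S"
    proof (rule transI)
      fix u v w
      assume uv: "(u, v) \<in> S" "(v, w) \<in> S"
      then have "trans (r (tr u))"
        using tr[of u] lin unfolding S_def strict_linear_order_on_def by auto
      then show "(u, w) \<in> S"
        using uv transD[of "r (tr u)" u v w] unfolding S_def by auto
    qed
    show "irrefl S"
      using tr lin unfolding S_def strict_linear_order_on_def irrefl_def by auto
    show "total_on (verts G) S"
      unfolding total_on_def
    proof (intro ballI impI)
      fix u v
      assume uv: "u \<in> verts G" "v \<in> verts G" "u \<noteq> v"
      show "(u, v) \<in> S \<or> (v, u) \<in> S"
      proof (cases "tr u = tr v")
        case True
        then have "u \<in> V (tr u)" "v \<in> V (tr u)" "total_on (V (tr u)) (r (tr u))"
          using uv tr[of u] tr[of v] lin unfolding strict_linear_order_on_def by auto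
        then show ?thesis
          using uv True unfolding S_def total_on_def by auto
      next
        case False
        then show ?thesis
          using uv unfolding S_def by auto
      qed
    qed
  qed
  then obtain h :: "'a \<Rightarrow> nat"
    where h: "\<And>u v. \<lbrakk>u \<in> verts G; v \<in> verts G\<rbrakk> \<Longrightarrow> (u, v) \<in> S \<longleftrightarrow> h u < h v"
      and h_inj: "inj_on h (verts G)"
    using strict_linear_order_rank[OF fin] by blast
  define p where "p v = parabola (real (h v))" for v
  have "inj_on (\<lambda>v. real (h v)) (verts G)"
    using h_inj unfolding inj_on_def by simp
  then have drawing: "convex_drawing G p"
    unfolding p_def by (rule convex_drawing_parabola[OF G])
  have meet: "\<exists>!z. z \<in> edge_segment p {a, b} \<and> z \<in> edge_segment p {c, d}"
    if e: "{a, b} \<in> edges G" "{c, d} \<in> edges G" "{a, b} \<noteq> {c, d}"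
      and less: "tr a < tr b" and tr_eq: "tr c = tr a" "tr d = tr b" and le: "h a \<le> h c" for a b c d
  proof -
    have V: "a \<in> verts G" "b \<in> verts G" "c \<in> verts G" "d \<in> verts G"
      using e(1,2) G unfolding simple_graph_def by auto
    show ?thesis
    proof (cases "a = c")
      case True
      then have "h b \<noteq> h d"
        using e(3) V h_inj by (auto dest: inj_onD)
      then show ?thesis
        unfolding edge_segment_insert p_def True by (intro parabola_chords_share) simp
    next
      case False
      then have "h a \<noteq> h c"
        using V h_inj by (auto dest: inj_onD)
      with le have ac: "h a < h c"
        by simp
      then have "(a, c) \<in> r (tr a)"
        using h[of a c] V tr_eq(1) unfolding S_def by auto
      moreover have "a \<in> V (tr a)" "c \<in> V (tr a)" "b \<in> V (tr b)" "d \<in> V (tr b)" "tr a < t" "tr b < t"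
        using V tr tr_eq by metis+
      moreover have "\<not> X_crossing t V r {a, b} {c, d}"
        using no_cross e by blast
      ultimately have "(d, b) \<notin> r (tr b)"
        using less unfolding X_crossing_def by (metis less_irrefl)
      then have "\<not> h d < h b"
        using h[of d b] V tr_eq(2) unfolding S_def by auto
      show ?thesis
      proof (cases "b = d")
        case True
        then show ?thesis
          using parabola_chords_share[of "real (h a)" "real (h c)" "real (h b)"] \<open>h a \<noteq> h c\<close>
          unfolding edge_segment_insert p_def by (simp add: closed_segment_commute)
      next
        case False
        then have "h b \<noteq> h d"
          using V h_inj by (auto dest: inj_onD)
        with \<open>\<not> h d < h b\<close> have "h b < h d"
          by simp
        moreover have "h c < h b"
          using h[of c b] V less tr_eq(1) unfolding S_def by auto
        ultimately show ?thesis
          using ac unfolding edge_segment_insert p_def by (intro parabola_chords_cross) auto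
      qed
    qed
  qed
  define L where "L = {A. A \<subseteq> {..<t} \<and> card A = 2}"
  have "finite L"
    unfolding L_def by (rule finite_subset[of _ "Pow {..<t}"]) auto
  have edge: "\<exists>a b. e = {a, b} \<and> tr a < tr b" if e: "e \<in> edges G" for e
  proof -
    obtain a b where ab: "e = {a, b}" "a \<noteq> b"
      using e G unfolding simple_graph_def by (meson card_2_iff)
    moreover have "a \<in> verts G" "b \<in> verts G"
      using e G ab(1) unfolding simple_graph_def by auto
    ultimately have "tr a \<noteq> tr b"
      using proper[OF e, of a b "tr a"] tr[of a] tr[of b] by auto
    then show ?thesis
      using ab(1) by (metis insert_commute linorder_neqE_nat)
  qed
  have "(`) tr ` edges G \<subseteq> L"
  proof
    fix A
    assume "A \<in> (`) tr ` edges G"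
    then obtain e where e: "e \<in> edges G" "A = tr ` e"
      by blast
    moreover obtain a b where "e = {a, b}" "tr a < tr b"
      using edge[OF e(1)] by blast
    moreover have "e \<subseteq> verts G"
      using e(1) G unfolding simple_graph_def by blast
    ultimately show "A \<in> L"
      unfolding L_def using tr by auto
  qed
  with \<open>finite L\<close> obtain T where T: "indexed_partition (edges G) (card L) T"
    and T_edges: "\<And>i e. e \<in> T i \<Longrightarrow> e \<in> edges G"
    and T_tr: "\<And>i e f. \<lbrakk>e \<in> T i; f \<in> T i\<rbrakk> \<Longrightarrow> tr ` e = tr ` f"
    by (rule indexed_partition_by_label) blast
  have "thrackle p (T i)" for i
    unfolding thrackle_def
  proof (intro ballI impI)
    fix e f
    assume ef: "e \<in> T i" "f \<in> T i" "e \<noteq> f"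
    obtain a b c d where e: "e = {a, b}" "tr a < tr b" and f: "f = {c, d}" "tr c < tr d"
      using edge T_edges ef by meson
    moreover have "{tr a, tr b} = {tr c, tr d}"
      using T_tr[OF ef(1,2)] e(1) f(1) by simp
    ultimately have eq: "tr c = tr a" "tr d = tr b"
      by (auto simp: doubleton_eq_iff)
    show "\<exists>!z. z \<in> edge_segment p e \<and> z \<in> edge_segment p f"
    proof (cases "h a \<le> h c")
      case True
      then show ?thesis
        using meet[of a b c d] ef T_edges e f eq by blast
    next
      case False
      have "\<exists>!z. z \<in> edge_segment p {c, d} \<and> z \<in> edge_segment p {a, b}"
      proof (rule meet)
        show "{c, d} \<in> edges G" "{a, b} \<in> edges G"
          using T_edges ef(1,2) e(1) f(1) by blast+
        show "{c, d} \<noteq> {a, b}"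
          using ef(3) e(1) f(1) by blast
      qed (use f(2) eq False in auto)
      then show ?thesis
        unfolding e(1) f(1) by (simp add: conj_commute)
    qed
  qed
  then have "drawing_antithickness G p \<le> card L"
    unfolding drawing_antithickness_def using T by (intro Least_le) blast
  moreover have "convex_antithickness G \<le> drawing_antithickness G p"
    unfolding convex_antithickness_def using drawing by (intro Least_le) blast
  moreover have "card L = t choose 2"
    unfolding L_def n_subsets[OF finite_lessThan] card_lessThan ..
  ultimately show ?thesis
    by simp
qed

section \<open>From convex drawings to queues\<close>

text \<open>
  A line supports the points from above at \<open>u\<close>.  Vertical supporting lines (\<open>\<beta> = 0\<close>) are admitted,
  so that the leftmost and the rightmost point need no special treatment; points where the supporting
  line lies below are described by negating \<open>Y\<close>.
\<close>

definition upper :: "'a set \<Rightarrow> ('a \<Rightarrow> real) \<Rightarrow> ('a \<Rightarrow> real) \<Rightarrow> 'a \<Rightarrow> bool" where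
  "upper V X Y u \<longleftrightarrow> (\<exists>\<alpha> \<beta>. 0 \<le> \<beta> \<and> (\<alpha> \<noteq> 0 \<or> \<beta> \<noteq> 0) \<and>
     (\<forall>w\<in>V. \<alpha> * X w + \<beta> * Y w \<le> \<alpha> * X u + \<beta> * Y u))"

definition chord :: "('a \<Rightarrow> real) \<Rightarrow> ('a \<Rightarrow> real) \<Rightarrow> 'a \<Rightarrow> 'a \<Rightarrow> real \<Rightarrow> real" where
  "chord X Y a d x = Y a + (Y d - Y a) / (X d - X a) * (x - X a)"

lemma chord_commute:
  assumes "X a \<noteq> X d"
  shows "chord X Y a d = chord X Y d a"
proof
  fix x
  define m where "m = (Y d - Y a) / (X d - X a)"
  have "m * (X d - X a) = Y d - Y a"
    unfolding m_def using assms by simp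
  moreover have "(Y a - Y d) / (X a - X d) = m"
    unfolding m_def by (metis minus_diff_eq minus_divide_divide)
  ultimately show "chord X Y a d x = chord X Y d a x"
    unfolding chord_def m_def[symmetric] by (simp add: algebra_simps)
qed

lemma chord_ends: "X a \<noteq> X d \<Longrightarrow> chord X Y a d (X a) = Y a" "X a \<noteq> X d \<Longrightarrow> chord X Y a d (X d) = Y d"
  unfolding chord_def by simp_all

lemma chord_uminus: "chord X (\<lambda>w. - Y w) a d x = - chord X Y a d x"
proof -
  have "(- Y d - - Y a) / (X d - X a) = - ((Y d - Y a) / (X d - X a))"
    unfolding minus_divide_left by simp
  then show ?thesis
    unfolding chord_def by simp
qed

text \<open>
  A supporting line at a point strictly between two others cannot be vertical, and it passes above
  both of them, hence above their chord.
\<close>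

lemma upper_above_chord:
  assumes "upper V X Y u" and "a \<in> V" and "d \<in> V" and "X a < X u" and "X u < X d"
  shows "chord X Y a d (X u) \<le> Y u"
proof -
  obtain \<alpha> \<beta> where \<beta>: "0 \<le> \<beta>" "\<alpha> \<noteq> 0 \<or> \<beta> \<noteq> 0"
    and le: "\<And>w. w \<in> V \<Longrightarrow> \<alpha> * X w + \<beta> * Y w \<le> \<alpha> * X u + \<beta> * Y u"
    using assms(1) unfolding upper_def by blast
  have "\<beta> \<noteq> 0"
  proof
    assume "\<beta> = 0"
    then have "\<alpha> * X a \<le> \<alpha> * X u" "\<alpha> * X d \<le> \<alpha> * X u"
      using le[OF assms(2)] le[OF assms(3)] by auto
    then have "\<alpha> = 0"
      using assms(4,5) by (auto simp: mult_le_cancel_left)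
    with \<open>\<beta> = 0\<close> \<beta>(2) show False
      by simp
  qed
  with \<beta>(1) have "0 < \<beta>"
    by simp
  have "(X d - X u) * (\<alpha> * X a + \<beta> * Y a) + (X u - X a) * (\<alpha> * X d + \<beta> * Y d)
      \<le> (X d - X u) * (\<alpha> * X u + \<beta> * Y u) + (X u - X a) * (\<alpha> * X u + \<beta> * Y u)"
    using assms(4,5) by (intro add_mono[OF mult_left_mono[OF le[OF assms(2)]] mult_left_mono[OF le[OF assms(3)]]]) auto
  then have "\<beta> * ((X d - X u) * Y a + (X u - X a) * Y d) \<le> \<beta> * ((X d - X a) * Y u)"
    by (simp add: algebra_simps)
  then have "(X d - X u) * Y a + (X u - X a) * Y d \<le> (X d - X a) * Y u"
    using \<open>0 < \<beta>\<close> by simp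
  moreover have "X d - X a > 0"
    using assms(4,5) by simp
  ultimately show ?thesis
    unfolding chord_def by (simp add: field_simps)
qed

lemma affine_positive_between:
  fixes p q :: real
  assumes "0 < p + q * \<alpha>" and "0 < p + q * \<beta>" and "\<alpha> \<le> x" and "x \<le> \<beta>"
  shows "0 < p + q * x"
proof (cases "0 \<le> q")
  case True
  then show ?thesis
    using assms mult_left_mono[OF assms(3) True] by linarith
next
  case False
  then show ?thesis
    using assms mult_left_mono_neg[OF assms(4), of q] by linarith
qed

text \<open>
  Points of the plane in weakly convex position, with distinct first coordinates.
\<close>

locale two_sided_points =
  fixes V :: "'a set" and X Y :: "'a \<Rightarrow> real"
  assumes inj: "inj_on X V"
    and two_sided: "v \<in> V \<Longrightarrow> upper V X Y v \<or> upper V X (\<lambda>w. - Y w) v"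
begin

abbreviation up :: "'a \<Rightarrow> bool" where
  "up \<equiv> upper V X Y"

text \<open>
  One turn around the convex hull, starting at the left: upper points from left to right, then
  the others from right to left.
\<close>

definition boundary_order :: "('a \<times> 'a) set" where
  "boundary_order = {(u, v). u \<in> V \<and> v \<in> V \<and>
     (up u \<and> \<not> up v \<or> up u \<and> up v \<and> X u < X v \<or> \<not> up u \<and> \<not> up v \<and> X v < X u)}"

lemma boundary_order_linear: "strict_linear_order_on V boundary_order"
  unfolding strict_linear_order_on_def
proof (intro conjI)
  show "trans boundary_order"
    unfolding trans_def boundary_order_def by auto
  show "irrefl boundary_order"
    unfolding irrefl_def boundary_order_def by auto
  show "total_on V boundary_order"
    unfolding total_on_def
  proof (intro ballI impI)
    fix u v
    assume "u \<in> V" "v \<in> V" "u \<noteq> v"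
    moreover from this have "X u \<noteq> X v"
      using inj by (auto dest: inj_onD)
    ultimately show "(u, v) \<in> boundary_order \<or> (v, u) \<in> boundary_order"
      unfolding boundary_order_def by auto
  qed
qed

lemma strictly_beside_chord:
  assumes "u \<in> V" and "a \<in> V" and "d \<in> V"
    and "X a < X u \<and> X u < X d \<or> X d < X u \<and> X u < X a"
    and "Y u \<noteq> chord X Y a d (X u)"
  shows "if up u then chord X Y a d (X u) < Y u else Y u < chord X Y a d (X u)"
proof -
  have *: "if up u then chord X Y v w (X u) < Y u else Y u < chord X Y v w (X u)"
    if vw: "v \<in> V" "w \<in> V" "X v < X u" "X u < X w" and ne: "Y u \<noteq> chord X Y v w (X u)" for v w
  proof (cases "up u")
    case True
    then show ?thesis
      using upper_above_chord[OF True vw] ne by simp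
  next
    case False
    then have "upper V X (\<lambda>w. - Y w) u"
      using two_sided assms(1) by blast
    from upper_above_chord[OF this vw] show ?thesis
      using False ne by (simp add: chord_uminus)
  qed
  from assms(4) show ?thesis
  proof
    assume "X a < X u \<and> X u < X d"
    then show ?thesis
      using *[OF assms(2,3)] assms(5) by blast
  next
    assume less: "X d < X u \<and> X u < X a"
    then have "chord X Y a d = chord X Y d a"
      by (intro chord_commute) simp
    then show ?thesis
      using less *[OF assms(3,2)] assms(5) by simp
  qed
qed

text \<open>
  The common range of the two chords on the first axis is bounded by two of the four points.  At
  each of these two, the vertex lies strictly beside the other chord, on the side given by its being
  an upper point or not.  The ordering makes these sides such that one chord is above the other
  at both ends of the range, and thus on all of it.
\<close>

lemma nested_chords_disjoint:
  assumes nested: "(a, b) \<in> boundary_order" "(b, c) \<in> boundary_order" "(c, d) \<in> boundary_order"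
    and off: "\<And>u. \<lbrakk>u \<in> {b, c}; X a < X u \<and> X u < X d \<or> X d < X u \<and> X u < X a\<rbrakk> \<Longrightarrow> Y u \<noteq> chord X Y a d (X u)"
      "\<And>u. \<lbrakk>u \<in> {a, d}; X b < X u \<and> X u < X c \<or> X c < X u \<and> X u < X b\<rbrakk> \<Longrightarrow> Y u \<noteq> chord X Y b c (X u)"
    and x: "X a \<le> x \<and> x \<le> X d \<or> X d \<le> x \<and> x \<le> X a" "X b \<le> x \<and> x \<le> X c \<or> X c \<le> x \<and> x \<le> X b"
  shows "chord X Y a d x \<noteq> chord X Y b c x"
proof
  assume eq: "chord X Y a d x = chord X Y b c x"
  have V: "a \<in> V" "b \<in> V" "c \<in> V" "d \<in> V"
    using nested unfolding boundary_order_def by auto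
  have X_ne: "X u \<noteq> X v" if "(u, v) \<in> boundary_order" for u v
  proof
    assume "X u = X v"
    moreover from this have "u = v"
      using that inj_onD[OF inj, of u v] unfolding boundary_order_def by auto
    ultimately show False
      using that unfolding boundary_order_def by auto
  qed
  have "trans boundary_order"
    using boundary_order_linear unfolding strict_linear_order_on_def by blast
  note t = transD[OF this]
  have ad: "X a \<noteq> X d" and bc: "X b \<noteq> X c" and bd: "X b \<noteq> X d" and ac: "X a \<noteq> X c"
    and ab: "X a \<noteq> X b" and cd: "X c \<noteq> X d"
    by (rule X_ne, use nested t in blast)+
  define m where "m = (Y d - Y a) / (X d - X a)"
  define n where "n = (Y c - Y b) / (X c - X b)"
  define p where "p = (Y b - n * X b) - (Y a - m * X a)"
  define q where "q = n - m"
  have diff: "chord X Y b c y - chord X Y a d y = p + q * y" for y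
    unfolding chord_def p_def q_def m_def[symmetric] n_def[symmetric] by (simp add: algebra_simps)
  have zero: "p + q * x = 0"
    using diff[of x] eq by simp
  have inner: "if up u then 0 < p + q * X u else p + q * X u < 0"
    if u: "u \<in> {b, c}" and between: "X a < X u \<and> X u < X d \<or> X d < X u \<and> X u < X a" for u
  proof -
    have "chord X Y b c (X u) = Y u"
      using u ad bc by (auto simp: chord_ends)
    moreover have "u \<in> V"
      using u V by auto
    ultimately show ?thesis
      using strictly_beside_chord[OF _ V(1,4) between off(1)[OF u between]] diff[of "X u"] by (simp split: if_splits)
  qed
  have outer: "if up u then p + q * X u < 0 else 0 < p + q * X u"
    if u: "u \<in> {a, d}" and between: "X b < X u \<and> X u < X c \<or> X c < X u \<and> X u < X b" for u
  proof -
    have "chord X Y a d (X u) = Y u"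
      using u ad bc by (auto simp: chord_ends)
    moreover have "u \<in> V"
      using u V by auto
    ultimately show ?thesis
      using strictly_beside_chord[OF _ V(2,3) between off(2)[OF u between]] diff[of "X u"] by (simp split: if_splits)
  qed
  have no_pos: False if "0 < p + q * \<alpha>" "0 < p + q * \<beta>" "\<alpha> \<le> x" "x \<le> \<beta>" for \<alpha> \<beta>
    using affine_positive_between[OF that] zero by simp
  have no_neg: False if "p + q * \<alpha> < 0" "p + q * \<beta> < 0" "\<alpha> \<le> x" "x \<le> \<beta>" for \<alpha> \<beta>
    using affine_positive_between[of "- p" "- q" \<alpha> \<beta> x] that zero by simp
  \<comment> \<open>The letters say which of \<open>a, b, c, d\<close> are upper points.\<close>
  consider (UUUU) "up a" "up b" "up c" "up d" "X a < X b" "X b < X c" "X c < X d"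
    | (UUUL) "up a" "up b" "up c" "\<not> up d" "X a < X b" "X b < X c"
    | (UULL) "up a" "up b" "\<not> up c" "\<not> up d" "X a < X b" "X d < X c"
    | (ULLL) "up a" "\<not> up b" "\<not> up c" "\<not> up d" "X d < X c" "X c < X b"
    | (LLLL) "\<not> up a" "\<not> up b" "\<not> up c" "\<not> up d" "X d < X c" "X c < X b" "X b < X a"
    using nested unfolding boundary_order_def mem_Collect_eq case_prod_conv by argo
  then show False
  proof cases
    case UUUU
    then have "0 < p + q * X b" "0 < p + q * X c"
      using inner[of b] inner[of c] by simp_all
    moreover have "X b \<le> x" "x \<le> X c"
      using UUUU x by argo+
    ultimately show ?thesis
      by (rule no_pos)
  next
    case UUUL
    have less: "X b < X d" "X b \<le> x" "x \<le> X c" "x \<le> X d"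
      using UUUL x ad bd ac by argo+
    then have pos: "0 < p + q * X b"
      using UUUL inner[of b] by simp
    show ?thesis
    proof (cases "X c < X d")
      case True
      then have "0 < p + q * X c"
        using UUUL inner[of c] by simp
      with pos show ?thesis
        using less(2,3) by (rule no_pos)
    next
      case False
      then have "X d < X c"
        using cd by simp
      then have "0 < p + q * X d"
        using UUUL less(1) outer[of d] by simp
      with pos show ?thesis
        using less(2,4) by (rule no_pos)
    qed
  next
    case UULL
    \<comment> \<open>In every other arrangement the two chords have no common range.\<close>
    have "X a < X b \<and> X b < X d \<and> X d < X c \<and> X b \<le> x \<and> x \<le> X d \<or>
        X d < X c \<and> X c < X a \<and> X a < X b \<and> X c \<le> x \<and> x \<le> X a"
      using UULL x ad bd ac by argo
    then show ?thesis
    proof (elim disjE conjE)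
      assume less: "X a < X b" "X b < X d" "X d < X c" "X b \<le> x" "x \<le> X d"
      then have "0 < p + q * X b" "0 < p + q * X d"
        using UULL inner[of b] outer[of d] by simp_all
      then show ?thesis
        using less(4,5) by (rule no_pos)
    next
      assume less: "X d < X c" "X c < X a" "X a < X b" "X c \<le> x" "x \<le> X a"
      then have "p + q * X c < 0" "p + q * X a < 0"
        using UULL inner[of c] outer[of a] by simp_all
      then show ?thesis
        using less(4,5) by (rule no_neg)
    qed
  next
    case ULLL
    have less: "X c < X a" "X c \<le> x" "x \<le> X b" "x \<le> X a"
      using ULLL x ad bd ac by argo+
    then have neg: "p + q * X c < 0"
      using ULLL inner[of c] by simp
    show ?thesis
    proof (cases "X b < X a")
      case True
      then have "p + q * X b < 0"
        using ULLL inner[of b] by simp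
      with neg show ?thesis
        using less(2,3) by (rule no_neg)
    next
      case False
      then have "X a < X b"
        using ab by simp
      then have "p + q * X a < 0"
        using ULLL less(1) outer[of a] by simp
      with neg show ?thesis
        using less(2,4) by (rule no_neg)
    qed
  next
    case LLLL
    then have "p + q * X c < 0" "p + q * X b < 0"
      using inner[of b] inner[of c] by simp_all
    moreover have "X c \<le> x" "x \<le> X b"
      using LLLL x by argo+
    ultimately show ?thesis
      by (rule no_neg)
  qed
qed

end

text \<open>
  Convex sets with empty interior, such as the hull of collinear points, are included: they lie in a
  line, which supports them at every point.
\<close>

lemma frontier_support:
  fixes S :: "complex set"
  assumes "convex S" and "z \<in> frontier S"
  obtains n where "n \<noteq> 0" and "\<And>w. w \<in> S \<Longrightarrow> n \<bullet> w \<le> n \<bullet> z"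
proof (cases "interior S = {}")
  case True
  then obtain n b where n: "n \<noteq> 0" "S \<subseteq> {x. n \<bullet> x = b}"
    using empty_interior_subset_hyperplane[OF assms(1)] by metis
  have "closure S \<subseteq> {x. n \<bullet> x = b}"
    using n(2) by (intro closure_minimal closed_hyperplane)
  moreover have "z \<in> closure S"
    using assms(2) unfolding frontier_def by blast
  ultimately have "n \<bullet> z = b"
    by blast
  then show ?thesis
    using n that[of n] by fastforce
next
  case False
  have "z \<notin> interior S"
    using assms(2) unfolding frontier_def by blast
  then obtain n b where n: "n \<noteq> 0" "\<forall>x\<in>interior S. n \<bullet> x \<le> b" "n \<bullet> z \<ge> b"
    using separating_hyperplane_sets[of "interior S" "{z}"] False assms(1) by (auto simp: convex_interior)
  have "closure (interior S) \<subseteq> {x. n \<bullet> x \<le> b}"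
    using n(2) by (intro closure_minimal closed_halfspace_le) auto
  then have "S \<subseteq> {x. n \<bullet> x \<le> b}"
    using convex_closure_interior[OF assms(1) False] closure_subset by blast
  then show ?thesis
    using n(1,3) that[of n] by fastforce
qed

text \<open>
  A shear preserves lines, so it serves to make the first coordinates distinct.  Each pair of points
  excludes at most one value of \<open>s\<close>.
\<close>

lemma separating_shear:
  fixes A :: "complex set"
  assumes "finite A"
  obtains s where "inj_on (\<lambda>z. Re z + s * Im z) A"
proof -
  have "finite ((\<lambda>(z, w). (Re w - Re z) / (Im z - Im w)) ` (A \<times> A))"
    using assms by simp
  then obtain s where s: "s \<notin> (\<lambda>(z, w). (Re w - Re z) / (Im z - Im w)) ` (A \<times> A)"
    using ex_new_if_finite infinite_UNIV_char_0 by blast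
  have "z = w" if zw: "z \<in> A" "w \<in> A" "Re z + s * Im z = Re w + s * Im w" for z w
  proof -
    have eq: "s * (Im z - Im w) = Re w - Re z"
      using zw(3) by (simp add: algebra_simps)
    have "Im z = Im w"
    proof (rule ccontr)
      assume "Im z \<noteq> Im w"
      then have "s = (Re w - Re z) / (Im z - Im w)"
        using eq by (simp add: field_simps)
      then show False
        using s zw(1,2) by force
    qed
    then show ?thesis
      using eq by (simp add: complex_eq_iff)
  qed
  then show ?thesis
    using that unfolding inj_on_def by blast
qed

lemma segment_chord:
  assumes "z \<in> closed_segment (p a) (p d)"
    and X: "\<And>v. X v = Re (p v) + s * Im (p v)" and Y: "\<And>v. Y v = Im (p v)" and "X a \<noteq> X d"
  defines "x \<equiv> Re z + s * Im z"
  shows "X a \<le> x \<and> x \<le> X d \<or> X d \<le> x \<and> x \<le> X a" and "Im z = chord X Y a d x"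
proof -
  obtain t where t: "0 \<le> t" "t \<le> 1" "z = (1 - t) *\<^sub>R p a + t *\<^sub>R p d"
    using assms(1) unfolding in_segment by blast
  have x: "x = X a + t * (X d - X a)"
    unfolding x_def X t(3) by (simp add: algebra_simps)
  have "x \<in> closed_segment (X a) (X d)"
    unfolding in_segment using t(1,2) by (intro exI[of _ t]) (simp add: x algebra_simps)
  then show "X a \<le> x \<and> x \<le> X d \<or> X d \<le> x \<and> x \<le> X a"
    unfolding closed_segment_eq_real_ivl by (auto split: if_splits)
  have "Im z = Y a + t * (Y d - Y a)"
    unfolding Y t(3) by (simp add: algebra_simps)
  moreover have "(Y d - Y a) / (X d - X a) * (x - X a) = t * (Y d - Y a)"
    unfolding x using assms(4) by simp
  ultimately show "Im z = chord X Y a d x"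
    unfolding chord_def by simp
qed

lemma chord_segment:
  assumes X: "\<And>v. X v = Re (p v) + s * Im (p v)" and Y: "\<And>v. Y v = Im (p v)"
    and between: "X a < X u \<and> X u < X d \<or> X d < X u \<and> X u < X a" and "Y u = chord X Y a d (X u)"
  shows "p u \<in> closed_segment (p a) (p d)"
proof -
  define t where "t = (X u - X a) / (X d - X a)"
  have ne: "X d - X a \<noteq> 0"
    using between by auto
  then have tX: "t * (X d - X a) = X u - X a"
    unfolding t_def by simp
  have tY: "t * (Y d - Y a) = Y u - Y a"
    using assms(4) unfolding chord_def t_def by simp
  have t: "0 \<le> t" "t \<le> 1"
    using between unfolding t_def by (auto simp: divide_simps)
  have Im: "Im (p u) = (1 - t) * Im (p a) + t * Im (p d)"
    using tY unfolding Y by (simp add: algebra_simps)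
  have "Re (p u) + s * Im (p u) = (1 - t) * (Re (p a) + s * Im (p a)) + t * (Re (p d) + s * Im (p d))"
    using tX unfolding X by (simp add: algebra_simps)
  then have "Re (p u) = (1 - t) * Re (p a) + t * Re (p d)"
    unfolding Im by (simp add: algebra_simps)
  with Im t show ?thesis
    unfolding in_segment by (intro exI[of _ t]) (simp add: complex_eq_iff)
qed

text \<open>
  After a shear, every vertex has a supporting line from above or from below, because it lies on the
  frontier of the hull.  That vertices are never inside edges makes the comparisons with
  chords strict.
\<close>

lemma convex_drawing_order:
  assumes G: "simple_graph G" and drawing: "convex_drawing G p"
  obtains r where "strict_linear_order_on (verts G) r"
    and "\<And>e f. \<lbrakk>e \<in> edges G; f \<in> edges G; nest r e f\<rbrakk> \<Longrightarrow> edge_segment p e \<inter> edge_segment p f = {}"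
proof -
  have geometric: "inj_on p (verts G)"
    and off_edge: "\<And>e w. \<lbrakk>e \<in> edges G; w \<in> verts G - e\<rbrakk> \<Longrightarrow> p w \<notin> edge_segment p e"
    and frontier: "\<And>v. v \<in> verts G \<Longrightarrow> p v \<in> frontier (convex hull (p ` verts G))"
    using drawing unfolding convex_drawing_def geometric_drawing_def by blast+
  have "finite (p ` verts G)"
    using G unfolding simple_graph_def by simp
  then obtain s where s: "inj_on (\<lambda>z. Re z + s * Im z) (p ` verts G)"
    using separating_shear by blast
  define X where "X v = Re (p v) + s * Im (p v)" for v
  define Y where "Y v = Im (p v)" for v
  have "inj_on X (verts G)"
    using comp_inj_on[OF geometric s] unfolding X_def comp_def .
  moreover have "upper (verts G) X Y v \<or> upper (verts G) X (\<lambda>w. - Y w) v" if v: "v \<in> verts G" for v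
  proof -
    obtain n where n: "n \<noteq> 0" "\<And>w. w \<in> convex hull (p ` verts G) \<Longrightarrow> n \<bullet> w \<le> n \<bullet> p v"
      using frontier_support[OF convex_convex_hull frontier[OF v]] by blast
    define \<beta> where "\<beta> = Im n - s * Re n"
    have inner: "n \<bullet> p w = Re n * X w + \<beta> * Y w" for w
      unfolding X_def Y_def \<beta>_def inner_complex_def by (simp add: algebra_simps)
    have le: "Re n * X w + \<beta> * Y w \<le> Re n * X v + \<beta> * Y v" if "w \<in> verts G" for w
      using n(2)[of "p w"] that unfolding inner by (simp add: hull_inc)
    have ne: "Re n \<noteq> 0 \<or> \<beta> \<noteq> 0"
      using n(1) unfolding \<beta>_def by (auto simp: complex_eq_iff)
    show ?thesis
    proof (cases "0 \<le> \<beta>")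
      case True
      then have "upper (verts G) X Y v"
        unfolding upper_def using ne le by blast
      then show ?thesis
        by blast
    next
      case False
      then have "upper (verts G) X (\<lambda>w. - Y w) v"
        unfolding upper_def using ne le by (intro exI[of _ "Re n"] exI[of _ "- \<beta>"]) auto
      then show ?thesis
        by blast
    qed
  qed
  ultimately interpret two_sided_points "verts G" X Y
    by unfold_locales
  have disjoint: "edge_segment p {a, d} \<inter> edge_segment p {b, c} = {}"
    if e: "{a, d} \<in> edges G" "{b, c} \<in> edges G" "{a, d} \<inter> {b, c} = {}"
      and nested: "(a, b) \<in> boundary_order" "(b, c) \<in> boundary_order" "(c, d) \<in> boundary_order" for a b c d
  proof (rule ccontr)
    assume "\<not> ?thesis"
    then obtain z where z: "z \<in> closed_segment (p a) (p d)" "z \<in> closed_segment (p b) (p c)"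
      unfolding edge_segment_insert by blast
    have V: "a \<in> verts G" "b \<in> verts G" "c \<in> verts G" "d \<in> verts G"
      using nested unfolding boundary_order_def by auto
    have ne: "a \<noteq> d" "b \<noteq> c"
      using e(1,2) G unfolding simple_graph_def by (metis card_2_iff doubleton_eq_iff)+
    then have X_ne: "X a \<noteq> X d" "X b \<noteq> X c"
      using V inj_onD[OF inj] by blast+
    have off: "Y u \<noteq> chord X Y v w (X u)"
      if "u \<in> verts G" "{v, w} \<in> edges G" "u \<notin> {v, w}" "X v < X u \<and> X u < X w \<or> X w < X u \<and> X u < X v" for u v w
      using off_edge[OF that(2), of u] that chord_segment[of X p s Y v u w] X_def Y_def
      unfolding edge_segment_insert by blast
    have "chord X Y a d (Re z + s * Im z) \<noteq> chord X Y b c (Re z + s * Im z)"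
    proof (rule nested_chords_disjoint[OF nested])
      show "X a \<le> Re z + s * Im z \<and> Re z + s * Im z \<le> X d \<or> X d \<le> Re z + s * Im z \<and> Re z + s * Im z \<le> X a"
        by (rule segment_chord(1)[OF z(1) X_def Y_def X_ne(1)])
      show "X b \<le> Re z + s * Im z \<and> Re z + s * Im z \<le> X c \<or> X c \<le> Re z + s * Im z \<and> Re z + s * Im z \<le> X b"
        by (rule segment_chord(1)[OF z(2) X_def Y_def X_ne(2)])
      show "Y u \<noteq> chord X Y a d (X u)"
        if "u \<in> {b, c}" "X a < X u \<and> X u < X d \<or> X d < X u \<and> X u < X a" for u
        using that V e by (intro off) auto
      show "Y u \<noteq> chord X Y b c (X u)"
        if "u \<in> {a, d}" "X b < X u \<and> X u < X c \<or> X c < X u \<and> X u < X b" for u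
        using that V e by (intro off) auto
    qed
    then show False
      using segment_chord(2)[OF z(1) X_def Y_def X_ne(1)] segment_chord(2)[OF z(2) X_def Y_def X_ne(2)] by simp
  qed
  show ?thesis
  proof (rule that[OF boundary_order_linear])
    fix e f
    assume e: "e \<in> edges G" and f: "f \<in> edges G" and "nest boundary_order e f"
    then obtain a d b c where "e \<inter> f = {}" and ef: "e = {a, d}" "f = {b, c}"
      and "(a, b) \<in> boundary_order \<and> (b, c) \<in> boundary_order \<and> (c, d) \<in> boundary_order \<or>
       (b, a) \<in> boundary_order \<and> (a, d) \<in> boundary_order \<and> (d, c) \<in> boundary_order"
      unfolding nest_def by blast
    then show "edge_segment p e \<inter> edge_segment p f = {}"
      using disjoint[of a d b c] disjoint[of b c a d] e f by blast
  qed
qed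

lemma queue_layout_of_thrackles:
  assumes "simple_graph G" and "convex_drawing G p"
    and "indexed_partition (edges G) k T" and "\<And>i. i < k \<Longrightarrow> thrackle p (T i)"
  shows "\<exists>r. queue_layout G k r T"
proof -
  obtain r where r: "strict_linear_order_on (verts G) r"
    and disjoint: "\<And>e f. \<lbrakk>e \<in> edges G; f \<in> edges G; nest r e f\<rbrakk> \<Longrightarrow> edge_segment p e \<inter> edge_segment p f = {}"
    using convex_drawing_order[OF assms(1,2)] by blast
  have "queue r (T i)" if i: "i < k" for i
    unfolding queue_def
  proof (intro ballI notI)
    fix e f
    assume ef: "e \<in> T i" "f \<in> T i" "nest r e f"
    then have edges: "e \<in> edges G" "f \<in> edges G"
      using indexed_partition_memberD[OF assms(3) i] by blast+
    have "e \<noteq> f"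
      using ef(3) unfolding nest_def by auto
    then have "edge_segment p e \<inter> edge_segment p f \<noteq> {}"
      using assms(4)[OF i] ef(1,2) unfolding thrackle_def by blast
    then show False
      using disjoint[OF edges ef(3)] by simp
  qed
  then show ?thesis
    unfolding queue_layout_def using r assms(3) by blast
qed

lemma drawing_antithickness_partition:
  assumes "simple_graph G"
  obtains T where "indexed_partition (edges G) (drawing_antithickness G p) T"
    and "\<And>i. i < drawing_antithickness G p \<Longrightarrow> thrackle p (T i)"
proof -
  obtain T where "indexed_partition (edges G) (card (edges G)) T"
    and "\<And>i x y. \<lbrakk>x \<in> T i; y \<in> T i\<rbrakk> \<Longrightarrow> id x = id y"
    by (rule indexed_partition_by_label[OF simple_graph_finite_edges[OF assms], of id "edges G"]) auto
  then have "\<exists>T. indexed_partition (edges G) (card (edges G)) T \<and> (\<forall>i<card (edges G). thrackle p (T i))"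
    unfolding thrackle_def id_def by metis
  then have "\<exists>k T. indexed_partition (edges G) k T \<and> (\<forall>i<k. thrackle p (T i))"
    by blast
  from LeastI_ex[OF this] show ?thesis
    using that unfolding drawing_antithickness_def by blast
qed

lemma queue_layout_convex_antithickness:
  assumes "simple_graph G"
  shows "\<exists>r Q. queue_layout G (convex_antithickness G) r Q"
proof -
  have "\<exists>k p. convex_drawing G p \<and> drawing_antithickness G p = k"
    using convex_drawing_exists[OF assms] by blast
  from LeastI_ex[OF this] obtain p where p: "convex_drawing G p"
    "drawing_antithickness G p = convex_antithickness G"
    unfolding convex_antithickness_def by blast
  obtain T where "indexed_partition (edges G) (convex_antithickness G) T"
    "\<And>i. i < convex_antithickness G \<Longrightarrow> thrackle p (T i)"
    using drawing_antithickness_partition[OF assms, of p] unfolding p(2) by blast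
  then show ?thesis
    using queue_layout_of_thrackles[OF assms p(1)] by blast
qed



section \<open>The cycle of bounds\<close>

text \<open>
  The bounding functions need not be monotone, so the outer one is replaced by its running maximum.
\<close>

lemma bounded_by_trans:
  assumes "bounded_by \<alpha> \<beta>" and "bounded_by \<beta> \<gamma>"
  shows "bounded_by \<alpha> \<gamma>"
proof -
  obtain f g where f: "\<And>G. simple_graph G \<Longrightarrow> \<alpha> G \<le> f (\<beta> G)" and g: "\<And>G. simple_graph G \<Longrightarrow> \<beta> G \<le> g (\<gamma> G)"
    using assms unfolding bounded_by_def by blast
  have "\<alpha> G \<le> Max (f ` {..g (\<gamma> G)})" if "simple_graph G" for G
    using f[OF that] g[OF that] by (meson Max_ge atMost_iff finite_atMost finite_imageI imageI order_trans)
  then show ?thesis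
    unfolding bounded_by_def by (intro exI[of _ "\<lambda>n. Max (f ` {..g n})"]) blast
qed

lemma queue_number_bounded_by_convex_antithickness: "bounded_by queue_number convex_antithickness"
proof -
  have "queue_number G \<le> id (convex_antithickness G)" if "simple_graph G" for G :: "'a graph"
    unfolding queue_number_def id_apply using queue_layout_convex_antithickness[OF that] by (intro Least_le)
  then show ?thesis
    unfolding bounded_by_def by blast
qed

lemma track_layout_queue_number:
  assumes "simple_graph G"
  shows "\<exists>t\<le>track_bound (2 * queue_number G). \<exists>V r C. track_layout G 1 t V r C"
proof -
  have "\<exists>k r Q. queue_layout G k r Q"
    using queue_layout_convex_antithickness[OF assms] by blast
  from LeastI_ex[OF this] show ?thesis
    using track_layout_of_queue_layout[OF assms] unfolding queue_number_def by blast
qed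

lemma track_number_bounded_by_queue_number: "bounded_by track_number queue_number"
proof -
  have "track_number G \<le> track_bound (2 * queue_number G)" if G: "simple_graph G" for G :: "'a graph"
  proof -
    obtain t where t: "t \<le> track_bound (2 * queue_number G)" "\<exists>V r C. track_layout G 1 t V r C"
      using track_layout_queue_number[OF G] by blast
    have "track_number G \<le> t"
      unfolding track_number_def using t(2) by (rule Least_le)
    then show ?thesis
      using t(1) by simp
  qed
  then show ?thesis
    unfolding bounded_by_def by (intro exI[of _ "\<lambda>k. track_bound (2 * k)"]) blast
qed

lemma convex_antithickness_bounded_by_track_number: "bounded_by convex_antithickness track_number"
proof -
  have "convex_antithickness G \<le> track_number G choose 2" if G: "simple_graph G" for G :: "'a graph"
  proof -
    have "\<exists>t V r C. track_layout G 1 t V r C"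
      using track_layout_queue_number[OF G] by blast
    from LeastI_ex[OF this] show ?thesis
      using convex_antithickness_le_of_track_layout[OF G] unfolding track_number_def by blast
  qed
  then show ?thesis
    unfolding bounded_by_def by (intro exI[of _ "\<lambda>t. t choose 2"]) blast
qed

theorem theorem15:
  shows "tied (queue_number :: 'a graph \<Rightarrow> nat) track_number \<and>
    tied (track_number :: 'a graph \<Rightarrow> nat) convex_antithickness \<and>
    tied (queue_number :: 'a graph \<Rightarrow> nat) convex_antithickness"
proof -
  note qc = queue_number_bounded_by_convex_antithickness
    and tq = track_number_bounded_by_queue_number
    and ct = convex_antithickness_bounded_by_track_number
  show ?thesis
    unfolding tied_def
    using qc tq ct bounded_by_trans[OF qc ct] bounded_by_trans[OF tq qc] bounded_by_trans[OF ct tq]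
    by blast
qed

end
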